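(* If $n \geq 3$, then $C_3 \,\Box\, C_n$ is nearly dispersable.
   Context: Graphs are finite and simple; $\Box$ denotes the Cartesian product of graphs; $C_n$ is the cycle with $n$ vertices. A layout of a graph $G$ is a cyclic ordering $\omega$ of its vertex set. Two edges conflict with respect to $\omega$ if their four endpoints occur in alternating order in $\omega$ (equivalently, the corresponding chords of a circle cross). Two distinct edges are adjacent if they share a vertex. A $k$-page matching book embedding is a triple $(G,\omega,c)$ where $\omega$ is a layout of $G$ and $c:E_G\to\{1,\dots,k\}$ is a surjection such that $c(e)\neq c(e')$ whenever $e$ and $e'$ are adjacent or conflict with respect to $\omega$. The matching book thickness $mbt(G)$ is the least $k$ for which some $k$-page matching book embedding $(G,\omega,c)$ exists (minimum over all layouts $\omega$). With $\Delta(G)$ the maximum degree of $G$, $G$ is nearly dispersable if $mbt(G)=1+\Delta(G)$. *)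

theory Defs
  imports Main
begin

text \<open>
  A graph is given by its vertices and its edges, an edge being the set of its two endpoints.
\<close>

record 'a graph =
  verts :: "'a set"
  edges :: "'a set set"

definition simple_graph :: "'a graph \<Rightarrow> bool" where
  "simple_graph G \<longleftrightarrow> finite (verts G) \<and> (\<forall>e \<in> edges G. e \<subseteq> verts G \<and> card e = 2)"

definition degree :: "'a graph \<Rightarrow> 'a \<Rightarrow> nat" where
  "degree G v = card {e \<in> edges G. v \<in> e}"

definition max_degree :: "'a graph \<Rightarrow> nat" where
  "max_degree G = Max (degree G ` verts G)"

text \<open>Meaningful for \<open>n \<ge> 3\<close> only (see \<open>simple_graph_cycle\<close>): for \<open>n = 1\<close> the edge degenerates to a
  singleton, and for \<open>n = 2\<close> there is a single edge.\<close>

definition cycle_graph :: "nat \<Rightarrow> nat graph" where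
  "cycle_graph n = \<lparr>verts = {0..<n}, edges = {{i, Suc i mod n} | i. i < n}\<rparr>"

definition cartesian_product :: "'a graph \<Rightarrow> 'b graph \<Rightarrow> ('a \<times> 'b) graph" where
  "cartesian_product G H =
    \<lparr>verts = verts G \<times> verts H,
     edges = {{(u, v), (u, v')} | u v v'. u \<in> verts G \<and> {v, v'} \<in> edges H} \<union>
             {{(u, v), (u', v)} | u u' v. {u, u'} \<in> edges G \<and> v \<in> verts H}\<rparr>"

text \<open>
  A cyclic ordering of the vertices is represented by listing them once each, starting from an
  arbitrary vertex. Lists that differ by a rotation represent the same cyclic ordering; the
  only notion that depends on the list, \<open>conflict\<close>, is invariant under rotation
  (\<open>conflict_rotate\<close>).
\<close>

definition layout :: "'a graph \<Rightarrow> 'a list \<Rightarrow> bool" where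
  "layout G \<omega> \<longleftrightarrow> distinct \<omega> \<and> set \<omega> = verts G"

text \<open>The unordered pair \<open>{e, f}\<close> leaves open which edge owns the first of the four endpoints.\<close>

definition conflict :: "'a list \<Rightarrow> 'a set \<Rightarrow> 'a set \<Rightarrow> bool" where
  "conflict \<omega> e f \<longleftrightarrow>
    (\<exists>i j k l. i < j \<and> j < k \<and> k < l \<and> l < length \<omega> \<and>
       {e, f} = {{\<omega> ! i, \<omega> ! k}, {\<omega> ! j, \<omega> ! l}})"

definition adjacent :: "'a set \<Rightarrow> 'a set \<Rightarrow> bool" where
  "adjacent e f \<longleftrightarrow> e \<noteq> f \<and> e \<inter> f \<noteq> {}"

definition matching_book_embedding ::
  "nat \<Rightarrow> 'a graph \<Rightarrow> 'a list \<Rightarrow> ('a set \<Rightarrow> nat) \<Rightarrow> bool" where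
  "matching_book_embedding k G \<omega> c \<longleftrightarrow>
    layout G \<omega> \<and> c ` edges G = {1..k} \<and>
    (\<forall>e \<in> edges G. \<forall>f \<in> edges G. adjacent e f \<or> conflict \<omega> e f \<longrightarrow> c e \<noteq> c f)"

text \<open>For simple graphs the minimum exists, see \<open>matching_book_embedding_exists\<close>.\<close>

definition mbt :: "'a graph \<Rightarrow> nat" where
  "mbt G = (LEAST k. \<exists>\<omega> c. matching_book_embedding k G \<omega> c)"

definition nearly_dispersable :: "'a graph \<Rightarrow> bool" where
  "nearly_dispersable G \<longleftrightarrow> mbt G = 1 + max_degree G"

lemma simple_graph_cycle:
  assumes "n \<ge> 3"
  shows "simple_graph (cycle_graph n)"
proof -
  have "Suc i mod n \<noteq> i" if "i < n" for i
    using assms that by (cases "Suc i = n") auto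
  then show ?thesis
    using assms by (fastforce simp: simple_graph_def cycle_graph_def card_2_iff)
qed

lemma simple_graph_cartesian_product:
  assumes "simple_graph G" "simple_graph H"
  shows "simple_graph (cartesian_product G H)"
proof -
  have G: "u \<in> verts G \<and> u' \<in> verts G \<and> u \<noteq> u'" if "{u, u'} \<in> edges G" for u u'
    using assms(1) that unfolding simple_graph_def by fastforce
  have H: "u \<in> verts H \<and> u' \<in> verts H \<and> u \<noteq> u'" if "{u, u'} \<in> edges H" for u u'
    using assms(2) that unfolding simple_graph_def by fastforce
  show ?thesis
    using assms unfolding simple_graph_def cartesian_product_def
    by (auto dest: G H)
qed

lemma conflict_rotate1:
  assumes "conflict \<omega> e f"
  shows "conflict (rotate1 \<omega>) e f"
proof -
  obtain i j k l where *: "i < j" "j < k" "k < l" "l < length \<omega>"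
    and ef: "{e, f} = {{\<omega> ! i, \<omega> ! k}, {\<omega> ! j, \<omega> ! l}}"
    using assms unfolding conflict_def by blast
  have nth: "rotate1 \<omega> ! (m - 1) = \<omega> ! m" if "0 < m" "m < length \<omega>" for m
    using that by (simp add: nth_rotate1)
  show ?thesis
  proof (cases "i = 0")
    case True
    have last: "rotate1 \<omega> ! (length \<omega> - 1) = \<omega> ! i"
      using *(4) True by (cases \<omega>) (auto simp: nth_append)
    have m: "0 < j" "0 < k" "0 < l" "j < length \<omega>" "k < length \<omega>" "l < length \<omega>"
      using * by linarith+
    have "{e, f} = {{\<omega> ! j, \<omega> ! l}, {\<omega> ! k, \<omega> ! i}}"
      unfolding ef by (simp only: insert_commute)
    then have "{e, f} = {{rotate1 \<omega> ! (j - 1), rotate1 \<omega> ! (l - 1)},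
                         {rotate1 \<omega> ! (k - 1), rotate1 \<omega> ! (length \<omega> - 1)}}"
      by (simp only: last nth m)
    moreover have "j - 1 < k - 1" "k - 1 < l - 1" "l - 1 < length \<omega> - 1"
      "length \<omega> - 1 < length (rotate1 \<omega>)"
      using * by auto
    ultimately show ?thesis
      unfolding conflict_def by blast
  next
    case False
    have m: "0 < i" "0 < j" "0 < k" "0 < l"
      "i < length \<omega>" "j < length \<omega>" "k < length \<omega>" "l < length \<omega>"
      using * False by linarith+
    have "{e, f} = {{rotate1 \<omega> ! (i - 1), rotate1 \<omega> ! (k - 1)},
                    {rotate1 \<omega> ! (j - 1), rotate1 \<omega> ! (l - 1)}}"
      using ef by (simp only: nth m)
    moreover have "i - 1 < j - 1" "j - 1 < k - 1" "k - 1 < l - 1"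
      "l - 1 < length (rotate1 \<omega>)"
      using * m by auto
    ultimately show ?thesis
      unfolding conflict_def by blast
  qed
qed

lemma conflict_rotate: "conflict (rotate m \<omega>) e f \<longleftrightarrow> conflict \<omega> e f"
proof -
  have up: "conflict (rotate m \<omega>) e f" if "conflict \<omega> e f" for m and \<omega> :: "'a list"
    using that by (induction m) (auto intro: conflict_rotate1)
  have "rotate (length \<omega> - m mod length \<omega>) (rotate m \<omega>) = \<omega>"
  proof (cases "\<omega> = []")
    case False
    then have "(length \<omega> - m mod length \<omega> + m) mod length \<omega> = 0"
      by (metis add.commute le_add_diff_inverse length_greater_0_conv less_imp_le mod_add_left_eq mod_less_divisor mod_self)
    then show ?thesis
      by (metis rotate_rotate rotate_id)
  qed simp
  then show ?thesis
    by (metis up)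
qed

lemma matching_book_embedding_exists:
  assumes "simple_graph G"
  shows "\<exists>k \<omega> c. matching_book_embedding k G \<omega> c"
proof -
  have "edges G \<subseteq> Pow (verts G)" "finite (verts G)"
    using assms by (auto simp: simple_graph_def)
  then have "finite (edges G)"
    by (meson finite_Pow_iff finite_subset)
  then obtain c where c: "bij_betw c (edges G) {1..card (edges G)}"
    by (metis ex_bij_betw_finite_nat finite_same_card_bij finite_atLeastAtMost card_atLeastAtMost diff_Suc_1)
  obtain \<omega> where \<omega>: "set \<omega> = verts G" "distinct \<omega>"
    using \<open>finite (verts G)\<close> finite_distinct_list by blast
  have "e \<noteq> f" if ef_conflict: "conflict \<omega> e f" for e f
  proof
    assume "e = f"
    obtain i j k l where *: "i < j" "j < k" "k < l" "l < length \<omega>"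
      and ef: "{e, f} = {{\<omega> ! i, \<omega> ! k}, {\<omega> ! j, \<omega> ! l}}"
      using ef_conflict unfolding conflict_def by blast
    have "{\<omega> ! i, \<omega> ! k} \<in> {e, f}" "{\<omega> ! j, \<omega> ! l} \<in> {e, f}"
      unfolding ef by blast+
    then have "{\<omega> ! i, \<omega> ! k} = {\<omega> ! j, \<omega> ! l}"
      using \<open>e = f\<close> by (simp only: insert_absorb2 singleton_iff)
    then have "\<omega> ! i \<in> {\<omega> ! j, \<omega> ! l}" by blast
    then show False
      using * \<omega>(2) by (auto simp: nth_eq_iff_index_eq)
  qed
  then have "matching_book_embedding (card (edges G)) G \<omega> c"
    using c \<omega> unfolding matching_book_embedding_def layout_def adjacent_def bij_betw_def inj_on_def
    by blast
  then show ?thesis by blast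
qed

end

theory Submission
  imports Defs
begin

text \<open>
  The graph \<open>C\<^sub>3 \<box> C\<^sub>n\<close> is 4-regular, so the claim is that its matching book thickness is 5.

  Four pages do not suffice, by a parity argument. If an
  \<open>r\<close>-regular graph is embedded in at most \<open>r\<close> pages, then every page is a perfect matching.
  Under an edge of such a page lie vertices which the page matches among themselves, hence evenly
  many; so every edge joins an even position of the layout to an odd one. The graph is then
  bipartite, which a triangle forbids (\<open>regular_triangle_degree_less_mbt\<close>).

  For five pages, the vertices are laid out triangle by triangle, and the direction of every
  second triangle is reversed. The three edges between consecutive triangles are then nested around
  the gap between the two blocks, and fit on one page. Two pages, used alternately,
  take all these links, and each of the three edges of a triangle gets a page of its own. It remains to
  place the three edges that close the cycle, from the last block back to the first. For even \<open>n\<close> these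
  two blocks have opposite directions, so the closing edges are nested as well and continue the
  alternation of the links. For odd \<open>n\<close> the two blocks have the same direction and the closing edges
  cross pairwise; they go to three different pages, which is possible after moving the last
  link and two triangle edges to other pages (\<open>odd_pages\<close>).
\<close>

section \<open>Book embeddings from noncrossing matchings\<close>

text \<open>
  All inequalities are strict, so that parallel chords have no common endpoint: this single relation
  excludes adjacent edges as well as conflicting ones.
\<close>

definition parallel :: "nat \<times> nat \<Rightarrow> nat \<times> nat \<Rightarrow> bool" where
  "parallel = (\<lambda>(x, y) (x', y'). y < x' \<or> y' < x \<or> (x < x' \<and> y' < y) \<or> (x' < x \<and> y < y'))"

definition noncrossing_matching :: "(nat \<times> nat) set \<Rightarrow> bool" where
  "noncrossing_matching P \<longleftrightarrow> (\<forall>(x, y) \<in> P. x < y) \<and> pairwise parallel P"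

lemma noncrossing_matchingD:
  assumes "noncrossing_matching P" "(x, y) \<in> P" "(x', y') \<in> P"
  shows "x < y"
    and "(x = x' \<and> y = y') \<or> y < x' \<or> y' < x \<or> (x < x' \<and> y' < y) \<or> (x' < x \<and> y < y')"
  using assms pairwiseD[of parallel P "(x, y)" "(x', y')"]
  by (auto simp: noncrossing_matching_def parallel_def)

text \<open>
  A layout is the order of the vertices by position, so that the positions may have gaps and an edge
  becomes a chord of the number line. The pages may overlap or be empty: an edge
  chooses one page that contains it, and the pages actually chosen are then renumbered, which yields
  the surjective colouring that a book embedding asks for.
\<close>

lemma mbt_le_length_pages:
  fixes G :: "'a graph" and pos :: "'a \<Rightarrow> nat"
  assumes G: "simple_graph G"
    and inj: "inj_on pos (verts G)"
    and noncrossing: "\<And>P. P \<in> set pages \<Longrightarrow> noncrossing_matching P"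
    and cover: "\<And>e. e \<in> edges G \<Longrightarrow> \<exists>P \<in> set pages. \<exists>u v. e = {u, v} \<and> (pos u, pos v) \<in> P"
  shows "mbt G \<le> length pages"
proof -
  obtain c where c: "\<And>e. e \<in> edges G \<Longrightarrow> c e \<in> set pages"
    "\<And>e. e \<in> edges G \<Longrightarrow> \<exists>u v. e = {u, v} \<and> (pos u, pos v) \<in> c e"
    using cover by metis
  obtain xs where xs: "set xs = verts G" "distinct xs"
    using G finite_distinct_list unfolding simple_graph_def by metis
  define \<omega> where "\<omega> = sort_key pos xs"
  have \<omega>: "set \<omega> = verts G" "distinct \<omega>" "sorted (map pos \<omega>)"
    using xs by (auto simp: \<omega>_def)
  have less: "pos (\<omega> ! i) < pos (\<omega> ! j)" if "i < j" "j < length \<omega>" for i j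
  proof -
    have "pos (\<omega> ! i) \<le> pos (\<omega> ! j)"
      using that \<omega>(3) by (simp add: sorted_iff_nth_mono_less)
    moreover have "\<omega> ! i \<noteq> \<omega> ! j"
      using that \<omega>(2) by (simp add: nth_eq_iff_index_eq)
    moreover have "\<omega> ! i \<in> verts G" "\<omega> ! j \<in> verts G"
      using that \<omega>(1) nth_mem by (metis less_trans)+
    ultimately show ?thesis
      using inj by (metis inj_onD le_neq_implies_less)
  qed
  have chord: "(pos u, pos v) \<in> c {u, v}" if e: "{u, v} \<in> edges G" and "pos u < pos v" for u v
  proof -
    obtain u' v' where uv: "{u, v} = {u', v'}" "(pos u', pos v') \<in> c {u, v}"
      using c(2)[OF e] by metis
    have "pos u' < pos v'"
      using noncrossing_matchingD(1)[OF noncrossing[OF c(1)[OF e]] uv(2) uv(2)] .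
    then show ?thesis
      using uv that by (auto simp: doubleton_eq_iff)
  qed
  have no_conflict: "c e \<noteq> c f" if ef: "e \<in> edges G" "f \<in> edges G" "conflict \<omega> e f" for e f
  proof
    assume eq: "c e = c f"
    obtain i j k l where *: "i < j" "j < k" "k < l" "l < length \<omega>"
      and ef': "{e, f} = {{\<omega> ! i, \<omega> ! k}, {\<omega> ! j, \<omega> ! l}}"
      using ef(3) unfolding conflict_def by blast
    have lt: "pos (\<omega> ! i) < pos (\<omega> ! j)" "pos (\<omega> ! j) < pos (\<omega> ! k)" "pos (\<omega> ! k) < pos (\<omega> ! l)"
      using * by (auto intro!: less)
    have "(pos (\<omega> ! i), pos (\<omega> ! k)) \<in> c e" "(pos (\<omega> ! j), pos (\<omega> ! l)) \<in> c e"
      using ef' ef(1,2) eq lt chord[of "\<omega> ! i" "\<omega> ! k"] chord[of "\<omega> ! j" "\<omega> ! l"]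
      by (auto simp: doubleton_eq_iff)
    from noncrossing_matchingD(2)[OF noncrossing[OF c(1)[OF ef(1)]] this] lt
    show False by linarith
  qed
  have no_adjacent: "c e \<noteq> c f" if ef: "e \<in> edges G" "f \<in> edges G" "adjacent e f" for e f
  proof
    assume eq: "c e = c f"
    obtain u v where e: "e = {u, v}" "(pos u, pos v) \<in> c e" using c(2)[OF ef(1)] by blast
    obtain u' v' where f: "f = {u', v'}" "(pos u', pos v') \<in> c e" using c(2)[OF ef(2)] eq by auto
    note nc = noncrossing[OF c(1)[OF ef(1)]]
    have lt: "pos u < pos v" "pos u' < pos v'"
      using noncrossing_matchingD(1)[OF nc] e f by blast+
    have V: "u \<in> verts G" "v \<in> verts G" "u' \<in> verts G" "v' \<in> verts G"
      using G ef e(1) f(1) by (auto simp: simple_graph_def)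
    have "e \<noteq> f" and "u = u' \<or> u = v' \<or> v = u' \<or> v = v'"
      using ef(3) e(1) f(1) by (auto simp: adjacent_def)
    then have "pos u = pos u' \<and> pos v = pos v'"
      using noncrossing_matchingD(2)[OF nc e(2) f(2)] lt by auto
    then have "u = u'" "v = v'"
      using V inj by (auto dest: inj_onD)
    then show False using \<open>e \<noteq> f\<close> e f by simp
  qed
  have sub: "c ` edges G \<subseteq> set pages" using c(1) by blast
  then have fin: "finite (c ` edges G)" using finite_subset by blast
  then obtain g where g: "bij_betw g (c ` edges G) {1..card (c ` edges G)}"
    using ex_bij_betw_nat_finite_1 bij_betw_inv by blast
  have "matching_book_embedding (card (c ` edges G)) G \<omega> (g \<circ> c)"
    unfolding matching_book_embedding_def layout_def
  proof (intro conjI ballI impI)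
    show "(g \<circ> c) ` edges G = {1..card (c ` edges G)}"
      using g by (simp add: bij_betw_def image_comp)
    show "(g \<circ> c) e \<noteq> (g \<circ> c) f"
      if "e \<in> edges G" "f \<in> edges G" "adjacent e f \<or> conflict \<omega> e f" for e f
    proof -
      have "c e \<noteq> c f" using that no_conflict no_adjacent by blast
      then show ?thesis
        using inj_on_eq_iff[OF bij_betw_imp_inj_on[OF g]] that by simp
    qed
  qed (use \<omega> in auto)
  then have "mbt G \<le> card (c ` edges G)"
    unfolding mbt_def by (intro Least_le) blast
  also have "\<dots> \<le> length pages"
    using sub by (meson List.finite_set card_length card_mono le_trans)
  finally show ?thesis .
qed

section \<open>Regular graphs with a triangle need an extra page\<close>

lemma conflictI:
  assumes "i < j" "j < k" "k < l" "l < length \<omega>"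
  shows "conflict \<omega> {\<omega> ! i, \<omega> ! k} {\<omega> ! j, \<omega> ! l}"
  using assms unfolding conflict_def by blast

lemma conflict_commute: "conflict \<omega> e f \<longleftrightarrow> conflict \<omega> f e"
  by (simp add: conflict_def insert_commute)

text \<open>
  With \<open>k \<le> r\<close> pages, each of the \<open>r\<close> edges at a vertex has its own page, so every vertex sees
  every page. The pages are therefore noncrossing perfect matchings, and these only contain
  edges between positions of different parity.
\<close>

lemma regular_triangle_degree_less_mbt:
  assumes G: "simple_graph G"
    and regular: "\<And>v. v \<in> verts G \<Longrightarrow> degree G v = r"
    and triangle: "{x, y} \<in> edges G" "{y, z} \<in> edges G" "{x, z} \<in> edges G"
  shows "r < mbt G"
proof (rule ccontr)
  assume "\<not> r < mbt G"
  define k where "k = mbt G"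
  have "k \<le> r" using \<open>\<not> r < mbt G\<close> by (simp add: k_def)
  obtain \<omega> c where emb: "matching_book_embedding k G \<omega> c"
    using LeastI_ex[OF matching_book_embedding_exists[OF G]] unfolding k_def mbt_def by blast
  then have \<omega>: "distinct \<omega>" "set \<omega> = verts G" and c: "c ` edges G = {1..k}"
    and proper: "\<And>e f. e \<in> edges G \<Longrightarrow> f \<in> edges G \<Longrightarrow> c e = c f \<Longrightarrow> \<not> adjacent e f \<and> \<not> conflict \<omega> e f"
    unfolding matching_book_embedding_def layout_def by blast+
  have edgeD: "e \<subseteq> verts G" "card e = 2" if "e \<in> edges G" for e
    using G that by (auto simp: simple_graph_def)
  have all_pages: "\<exists>e \<in> edges G. v \<in> e \<and> c e = p" if v: "v \<in> verts G" and p: "p \<in> {1..k}" for v p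
  proof -
    let ?E = "{e \<in> edges G. v \<in> e}"
    have "inj_on c ?E"
      using proper by (fastforce simp: inj_on_def adjacent_def)
    then have "card (c ` ?E) = r"
      using regular[OF v] by (simp add: card_image degree_def)
    moreover have sub: "c ` ?E \<subseteq> {1..k}" using c by blast
    ultimately have "card (c ` ?E) = card {1..k}"
      using \<open>k \<le> r\<close> card_mono[OF finite_atLeastAtMost sub] by simp
    then have "c ` ?E = {1..k}"
      by (rule card_subset_eq[OF finite_atLeastAtMost sub])
    then have "p \<in> c ` ?E" using p by simp
    then show ?thesis by auto
  qed
  have odd_gap: "odd (i + j)" if edge: "{\<omega> ! i, \<omega> ! j} \<in> edges G" and ij: "i < j" "j < length \<omega>" for i j
  proof -
    \<comment> \<open>The edges of page \<open>?p\<close> strictly under the given edge partition the vertices there into pairs.\<close>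
    let ?p = "c {\<omega> ! i, \<omega> ! j}"
    let ?inside = "(!) \<omega> ` {i<..<j}"
    let ?M = "{e \<in> edges G. c e = ?p \<and> e \<subseteq> ?inside}"
    have ends: "\<omega> ! i \<notin> ?inside" "\<omega> ! j \<notin> ?inside"
      using ij \<omega>(1) by (auto simp: nth_eq_iff_index_eq)
    have "?inside \<subseteq> \<Union>?M"
    proof
      fix v assume v: "v \<in> ?inside"
      then obtain m where m: "i < m" "m < j" "v = \<omega> ! m" by auto
      have "v \<in> verts G" using m ij \<omega>(2) by (metis less_trans nth_mem)
      moreover have "?p \<in> {1..k}" using edge c by blast
      ultimately obtain e where e: "e \<in> edges G" "v \<in> e" "c e = ?p"
        using all_pages by blast
      obtain w where w: "e = {v, w}" "v \<noteq> w"
        using edgeD(2)[OF e(1)] e(2) by (auto simp: card_2_iff)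
      have "w \<in> verts G" using edgeD(1)[OF e(1)] w by auto
      then obtain l where l: "w = \<omega> ! l" "l < length \<omega>" using \<omega>(2) by (metis in_set_conv_nth)
      \<comment> \<open>The partner \<open>w\<close> of \<open>v\<close> cannot lie outside, because \<open>e\<close> would cross the given edge.\<close>
      have no: "\<not> adjacent e {\<omega> ! i, \<omega> ! j}" "\<not> conflict \<omega> e {\<omega> ! i, \<omega> ! j}"
        using proper[OF e(1) edge e(3)] by auto
      have "e \<noteq> {\<omega> ! i, \<omega> ! j}" using v e(2) ends by blast
      then have "e \<inter> {\<omega> ! i, \<omega> ! j} = {}" using no(1) by (auto simp: adjacent_def)
      then have "l \<noteq> i" "l \<noteq> j" using w l by auto
      moreover have "\<not> l < i"
      proof
        assume "l < i"
        then have "conflict \<omega> {\<omega> ! l, \<omega> ! m} {\<omega> ! i, \<omega> ! j}"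
          using m ij by (intro conflictI) auto
        then have "conflict \<omega> e {\<omega> ! i, \<omega> ! j}"
          using w(1) m(3) l(1) by (simp add: insert_commute)
        then show False using no by simp
      qed
      moreover have "\<not> j < l"
      proof
        assume "j < l"
        then have "conflict \<omega> {\<omega> ! i, \<omega> ! j} {\<omega> ! m, \<omega> ! l}"
          using m ij l by (intro conflictI) auto
        then have "conflict \<omega> e {\<omega> ! i, \<omega> ! j}"
          using w(1) m(3) l(1) by (simp add: conflict_commute)
        then show False using no by simp
      qed
      ultimately have "w \<in> ?inside" using l by auto
      then show "v \<in> \<Union>?M" using e w v by blast
    qed
    then have union: "\<Union>?M = ?inside" by blast
    have "finite ?inside" by simp
    then have "finite ?M" by (rule finite_subset[rotated, OF finite_Pow_iff[THEN iffD2]]) auto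
    have "2 * card ?M = card (\<Union>?M)"
    proof (rule card_partition)
      show "finite (\<Union>?M)" unfolding union by simp
      show "e \<inter> f = {}" if "e \<in> ?M" "f \<in> ?M" "e \<noteq> f" for e f
        using that proper[of e f] by (auto simp: adjacent_def)
    qed (use \<open>finite ?M\<close> edgeD in auto)
    also have "\<dots> = j - i - 1"
      unfolding union using ij \<omega>(1) by (subst card_image) (auto simp: inj_on_def nth_eq_iff_index_eq)
    finally have "j = i + 2 * card ?M + 1" using ij by linarith
    then show ?thesis by presburger
  qed
  have parity: "odd (i + j)"
    if "{\<omega> ! i, \<omega> ! j} \<in> edges G" "i < length \<omega>" "j < length \<omega>" for i j
  proof -
    have "\<omega> ! i \<noteq> \<omega> ! j" using edgeD(2)[OF that(1)] by auto
    then have "i < j \<or> j < i" by (metis linorder_neqE_nat)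
    then show ?thesis
      using odd_gap[of i j] odd_gap[of j i] that by (auto simp: insert_commute add.commute)
  qed
  have "x \<in> set \<omega>" "y \<in> set \<omega>" "z \<in> set \<omega>"
    using edgeD(1) triangle \<omega>(2) by blast+
  then obtain i j l where ijl: "x = \<omega> ! i" "y = \<omega> ! j" "z = \<omega> ! l"
    "i < length \<omega>" "j < length \<omega>" "l < length \<omega>"
    by (metis in_set_conv_nth)
  have "odd (i + j)" "odd (j + l)" "odd (i + l)"
    using parity[of i j] parity[of j l] parity[of i l] triangle ijl by blast+
  then show False by presburger
qed

section \<open>Degrees in cycles and in Cartesian products\<close>

lemma finite_edges:
  assumes "simple_graph G"
  shows "finite (edges G)"
  using assms finite_subset[of "edges G" "Pow (verts G)"] by (auto simp: simple_graph_def)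

lemma degree_cartesian_product:
  assumes G: "simple_graph G" and H: "simple_graph H" and u: "u \<in> verts G" and v: "v \<in> verts H"
  shows "degree (cartesian_product G H) (u, v) = degree G u + degree H v"
proof -
  let ?A = "{e \<in> edges G. u \<in> e}" and ?B = "{e \<in> edges H. v \<in> e}"
  \<comment> \<open>The edges at \<open>(u, v)\<close> are copies of the edges at \<open>u\<close> and of the edges at \<open>v\<close>.\<close>
  let ?f = "\<lambda>e. e \<times> {v}" and ?g = "\<lambda>e. {u} \<times> e"
  have fin: "finite ?A" "finite ?B"
    using finite_edges[OF G] finite_edges[OF H] by simp_all
  have pairG: "\<exists>a b. e = {a, b} \<and> a \<noteq> b" if "e \<in> edges G" for e
    using G that by (auto simp: simple_graph_def card_2_iff)
  have pairH: "\<exists>a b. e = {a, b} \<and> a \<noteq> b" if "e \<in> edges H" for e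
    using H that by (auto simp: simple_graph_def card_2_iff)
  have "{e \<in> edges (cartesian_product G H). (u, v) \<in> e} = ?f ` ?A \<union> ?g ` ?B" (is "?L = ?R")
  proof
    show "?L \<subseteq> ?R"
    proof
      fix e assume "e \<in> ?L"
      then consider a b b' where "e = {(a, b), (a, b')}" "{b, b'} \<in> edges H" "(u, v) \<in> e"
        | a a' b where "e = {(a, b), (a', b)}" "{a, a'} \<in> edges G" "(u, v) \<in> e"
        unfolding cartesian_product_def by fastforce
      then show "e \<in> ?R"
      proof cases
        case 1
        then have "e = ?g {b, b'}" "v \<in> {b, b'}" by auto
        then show ?thesis using 1 by blast
      next
        case 2
        then have "e = ?f {a, a'}" "u \<in> {a, a'}" by auto
        then show ?thesis using 2 by blast
      qed
    qed
    show "?R \<subseteq> ?L"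
    proof
      fix e assume "e \<in> ?R"
      then consider d where "e = ?f d" "d \<in> edges G" "u \<in> d" | d where "e = ?g d" "d \<in> edges H" "v \<in> d"
        by blast
      then show "e \<in> ?L"
      proof cases
        case 1
        obtain a b where "d = {a, b}" using pairG 1 by blast
        then have "e = {(a, v), (b, v)}" "{a, b} \<in> edges G" using 1 by auto
        moreover have "(u, v) \<in> e" using 1 by simp
        ultimately show ?thesis using v unfolding cartesian_product_def by auto
      next
        case 2
        obtain a b where "d = {a, b}" using pairH 2 by blast
        then have "e = {(u, a), (u, b)}" "{a, b} \<in> edges H" using 2 by auto
        moreover have "(u, v) \<in> e" using 2 by simp
        ultimately show ?thesis using u unfolding cartesian_product_def by auto
      qed
    qed
  qed
  moreover have "?f ` ?A \<inter> ?g ` ?B = {}"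
  proof -
    have "?f d \<noteq> ?g d'" if d: "d \<in> ?A" "d' \<in> ?B" for d d'
    proof -
      obtain a b where "d = {a, b}" "a \<noteq> b" using pairG[of d] d(1) by auto
      then obtain w where "w \<in> d" "w \<noteq> u" by blast
      then have "(w, v) \<in> ?f d" "(w, v) \<notin> ?g d'" by auto
      then show ?thesis by metis
    qed
    then show ?thesis by blast
  qed
  moreover have "card (?f ` ?A) = card ?A" "card (?g ` ?B) = card ?B"
    by (auto intro!: card_image simp: inj_on_def times_eq_iff)
  ultimately show ?thesis
    unfolding degree_def using fin by (simp add: card_Un_disjoint)
qed

lemma verts_cycle_graph: "verts (cycle_graph n) = {0..<n}"
  by (simp add: cycle_graph_def)

lemma degree_cycle_graph:
  assumes n: "n \<ge> 3" and i: "i < n"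
  shows "degree (cycle_graph n) i = 2"
proof -
  define p where "p = (if i = 0 then n - 1 else i - 1)"
  have pred: "Suc j mod n = i \<longleftrightarrow> j = p" if "j < n" for j
    unfolding p_def using that i n by (cases "Suc j = n") auto
  have p: "p < n" "Suc p mod n = i"
    using pred[of p] i n by (auto simp: p_def)
  have "{e \<in> edges (cycle_graph n). i \<in> e} = {{i, Suc i mod n}, {p, Suc p mod n}}"
  proof (rule equalityI; rule subsetI)
    fix e assume "e \<in> {e \<in> edges (cycle_graph n). i \<in> e}"
    then obtain j where j: "e = {j, Suc j mod n}" "j < n" "i = j \<or> i = Suc j mod n"
      by (auto simp: cycle_graph_def)
    then have "j = i \<or> j = p" using pred[of j] by blast
    then show "e \<in> {{i, Suc i mod n}, {p, Suc p mod n}}" using j(1) by blast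
  next
    fix e assume "e \<in> {{i, Suc i mod n}, {p, Suc p mod n}}"
    then consider "e = {i, Suc i mod n}" | "e = {p, Suc p mod n}" by blast
    then show "e \<in> {e \<in> edges (cycle_graph n). i \<in> e}"
    proof cases
      case 1
      then show ?thesis using i unfolding cycle_graph_def by auto
    next
      case 2
      moreover have "i \<in> e" using 2 p(2) by simp
      ultimately show ?thesis using p(1) unfolding cycle_graph_def by auto
    qed
  qed
  moreover have "{i, Suc i mod n} \<noteq> {p, Suc p mod n}"
  proof -
    have "Suc i mod n \<noteq> p"
      using i n by (cases "Suc i = n") (auto simp: p_def)
    moreover have "i \<noteq> p" using i n by (auto simp: p_def)
    ultimately show ?thesis using p(2) by (auto simp: doubleton_eq_iff)
  qed
  ultimately show ?thesis by (simp add: degree_def)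
qed

section \<open>Combining noncrossing matchings\<close>

lemma noncrossing_matching_empty: "noncrossing_matching {}"
  by (simp add: noncrossing_matching_def)

lemma noncrossing_matching_insert:
  assumes "x < y" "\<And>x' y'. (x', y') \<in> P \<Longrightarrow> parallel (x, y) (x', y')" "noncrossing_matching P"
  shows "noncrossing_matching (insert (x, y) P)"
proof -
  have "parallel c d \<longleftrightarrow> parallel d c" for c d
    by (auto simp: parallel_def)
  then show ?thesis
    using assms unfolding noncrossing_matching_def by (auto simp: pairwise_insert)
qed

text \<open>Chords in disjoint intervals of the line, here of common length \<open>w\<close>, do not interact.\<close>

lemma noncrossing_matching_UN:
  fixes w s :: nat
  assumes P: "\<And>i. i < k \<Longrightarrow> noncrossing_matching (P i)"
    and range: "\<And>i x y. i < k \<Longrightarrow> (x, y) \<in> P i \<Longrightarrow> w * i + s \<le> x \<and> y < w * Suc i + s"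
  shows "noncrossing_matching (\<Union>i<k. P i)"
proof -
  have less: "y < x'" if "i < j" "j < k" "(x, y) \<in> P i" "(x', y') \<in> P j" for i j x y x' y'
  proof -
    have "w * Suc i \<le> w * j" using that by (intro mult_le_mono2) simp
    then show ?thesis using range[of i x y] range[of j x' y'] that by linarith
  qed
  show ?thesis
    unfolding noncrossing_matching_def
  proof (intro conjI pairwiseI ballI)
    show "case c of (x, y) \<Rightarrow> x < y" if "c \<in> (\<Union>i<k. P i)" for c
      using that P by (auto simp: noncrossing_matching_def)
  next
    fix c d assume cd: "c \<in> (\<Union>i<k. P i)" "d \<in> (\<Union>i<k. P i)" "c \<noteq> d"
    obtain i j where ij: "i < k" "c \<in> P i" "j < k" "d \<in> P j" using cd by blast
    obtain x y x' y' where xy: "c = (x, y)" "d = (x', y')" by fastforce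
    consider "i = j" | "i < j" | "j < i" by linarith
    then show "parallel c d"
    proof cases
      case 1
      then show ?thesis
        using P[of i] ij cd(3) by (auto simp: noncrossing_matching_def dest: pairwiseD)
    next
      case 2
      then show ?thesis using less[of i j x y x' y'] ij xy by (simp add: parallel_def)
    next
      case 3
      then show ?thesis using less[of j i x' y' x y] ij xy by (simp add: parallel_def)
    qed
  qed
qed

section \<open>Five pages for the product\<close>

text \<open>Vertex \<open>(a, i)\<close> lies in the block \<open>{3 * i..3 * i + 2}\<close>; odd blocks are traversed backwards.\<close>

definition snake :: "nat \<times> nat \<Rightarrow> nat" where
  "snake = (\<lambda>(a, i). 3 * i + (if even i then a else 2 - a))"

text \<open>
  Because of the reversal, the edges from block \<open>i\<close> to block \<open>i + 1\<close> form the same nested pattern for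
  even and for odd \<open>i\<close>.
\<close>

definition link :: "nat \<Rightarrow> (nat \<times> nat) set" where
  "link i = {(3 * i, 3 * i + 5), (3 * i + 1, 3 * i + 4), (3 * i + 2, 3 * i + 3)}"

definition triangle :: "nat \<Rightarrow> (nat \<times> nat) set" where
  "triangle i = {(3 * i, 3 * i + 1), (3 * i + 1, 3 * i + 2), (3 * i, 3 * i + 2)}"

text \<open>
  The pages for \<open>n = 2 * h\<close>. The odd links pair up the blocks \<open>1\<close> to \<open>2 * h - 2\<close>; this leaves
  the two outermost blocks of their page to the closing chords, which surround all these links.
\<close>

definition even_pages :: "nat \<Rightarrow> (nat \<times> nat) set list" where
  "even_pages h =
   [\<Union>i<2 * h. {(3 * i, 3 * i + 1)},
    \<Union>i<2 * h. {(3 * i + 1, 3 * i + 2)},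
    \<Union>i<2 * h. {(3 * i, 3 * i + 2)},
    \<Union>j<h. link (2 * j),
    {(0, 6 * h - 1), (1, 6 * h - 2), (2, 6 * h - 3)} \<union> (\<Union>j<h - 1. link (2 * j + 1))]"

text \<open>
  The pages for \<open>n = 2 * h + 1\<close>. The closing chords \<open>(a, 6 * h + a)\<close> cross pairwise. Those for
  \<open>a = 2\<close> and \<open>a = 0\<close> join the pages of short triangle chords, which leave the last, respectively
  first, position of every block free. The one for \<open>a = 1\<close> joins the odd links, but ends inside
  \<open>link (2 * h - 1)\<close>, which has to leave. That link moves to the page of the long triangle chords, where the
  chords of the blocks \<open>2 * h - 1\<close> and \<open>2 * h\<close> give way to it; the former takes the place that the link
  has left, and the latter fits on the page of the even links, which does not reach block \<open>2 * h\<close>.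
\<close>

definition odd_pages :: "nat \<Rightarrow> (nat \<times> nat) set list" where
  "odd_pages h =
   [{(2, 6 * h + 2)} \<union> (\<Union>i<2 * h + 1. {(3 * i, 3 * i + 1)}),
    {(0, 6 * h)} \<union> (\<Union>i<2 * h + 1. {(3 * i + 1, 3 * i + 2)}),
    link (2 * h - 1) \<union> (\<Union>i<2 * h - 1. {(3 * i, 3 * i + 2)}),
    {(6 * h, 6 * h + 2)} \<union> (\<Union>j<h. link (2 * j)),
    {(1, 6 * h + 1), (6 * h - 3, 6 * h - 1)} \<union> (\<Union>j<h - 1. link (2 * j + 1))]"

lemma length_even_pages: "length (even_pages h) = 5"
  by (simp add: even_pages_def)

lemma length_odd_pages: "length (odd_pages h) = 5"
  by (simp add: odd_pages_def)

lemma link_bounds: "(x, y) \<in> link i \<Longrightarrow> 3 * i \<le> x \<and> x < y \<and> y \<le> 3 * i + 5"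
  by (auto simp: link_def)

lemma noncrossing_matching_link: "noncrossing_matching (link i)"
  unfolding link_def
  by (intro noncrossing_matching_insert noncrossing_matching_empty) (auto simp: parallel_def)

lemma noncrossing_matching_periodic:
  "noncrossing_matching (\<Union>i<k. {(3 * i, 3 * i + 1)})"
  "noncrossing_matching (\<Union>i<k. {(3 * i + 1, 3 * i + 2)})"
  "noncrossing_matching (\<Union>i<k. {(3 * i, 3 * i + 2)})"
  by (rule noncrossing_matching_UN[where w = 3 and s = 0];
      auto intro: noncrossing_matching_insert noncrossing_matching_empty)+

lemma noncrossing_matching_alternate_links:
  "noncrossing_matching (\<Union>j<k. link (2 * j))"
  "noncrossing_matching (\<Union>j<k. link (2 * j + 1))"
proof -
  show "noncrossing_matching (\<Union>j<k. link (2 * j))"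
    by (rule noncrossing_matching_UN[where w = 6 and s = 0, OF noncrossing_matching_link])
      (auto simp: link_def)
  show "noncrossing_matching (\<Union>j<k. link (2 * j + 1))"
    by (rule noncrossing_matching_UN[where w = 6 and s = 3, OF noncrossing_matching_link])
      (auto simp: link_def)
qed

lemma even_pages_noncrossing:
  assumes "h \<ge> 1"
  shows "\<forall>P \<in> set (even_pages h). noncrossing_matching P"
proof -
  have "noncrossing_matching ({(0, 6 * h - 1), (1, 6 * h - 2), (2, 6 * h - 3)} \<union> (\<Union>j<h - 1. link (2 * j + 1)))"
    unfolding Un_insert_left Un_empty_left using assms
    by (intro noncrossing_matching_insert noncrossing_matching_alternate_links)
      (auto simp: parallel_def link_def)
  then show ?thesis
    unfolding even_pages_def list.set ball_simps
    by (intro conjI TrueI noncrossing_matching_periodic noncrossing_matching_alternate_links)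
qed

lemma odd_pages_noncrossing:
  assumes "h \<ge> 1"
  shows "\<forall>P \<in> set (odd_pages h). noncrossing_matching P"
proof -
  have "noncrossing_matching ({(2, 6 * h + 2)} \<union> (\<Union>i<2 * h + 1. {(3 * i, 3 * i + 1)}))"
    unfolding Un_insert_left Un_empty_left
    using assms by (intro noncrossing_matching_insert noncrossing_matching_periodic)
      (auto simp: parallel_def, presburger+)
  moreover have "noncrossing_matching ({(0, 6 * h)} \<union> (\<Union>i<2 * h + 1. {(3 * i + 1, 3 * i + 2)}))"
    unfolding Un_insert_left Un_empty_left using assms
    by (intro noncrossing_matching_insert noncrossing_matching_periodic)
      (auto simp: parallel_def, presburger+)
  moreover have "noncrossing_matching (link (2 * h - 1) \<union> (\<Union>i<2 * h - 1. {(3 * i, 3 * i + 2)}))"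
    unfolding link_def Un_insert_left Un_empty_left using assms
    by (intro noncrossing_matching_insert noncrossing_matching_periodic)
      (auto simp: parallel_def)
  moreover have "noncrossing_matching ({(6 * h, 6 * h + 2)} \<union> (\<Union>j<h. link (2 * j)))"
    unfolding Un_insert_left Un_empty_left
    by (intro noncrossing_matching_insert noncrossing_matching_alternate_links)
      (fastforce simp: parallel_def dest: link_bounds)+
  moreover have "noncrossing_matching
      ({(1, 6 * h + 1), (6 * h - 3, 6 * h - 1)} \<union> (\<Union>j<h - 1. link (2 * j + 1)))"
    unfolding Un_insert_left Un_empty_left using assms
    by (intro noncrossing_matching_insert noncrossing_matching_alternate_links)
      (auto simp: parallel_def link_def)
  ultimately show ?thesis
    unfolding odd_pages_def list.set ball_simps by (intro conjI TrueI)
qed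

text \<open>
  The edges of the cycle between its consecutive vertices are separated from the one that wraps
  around, because the layout treats them differently.
\<close>

lemma cartesian_product_cycle_cases:
  assumes "e \<in> edges (cartesian_product (cycle_graph 3) (cycle_graph n))"
  obtains (triangle) i a b where "i < n" "e = {(a, i), (b, i)}" "a < b" "b < 3"
  | (link) i a where "Suc i < n" "a < 3" "e = {(a, i), (a, Suc i)}"
  | (closing) a where "a < 3" "e = {(a, 0), (a, n - 1)}"
proof -
  have verts: "v \<in> verts (cycle_graph m) \<longleftrightarrow> v < m" for v m
    by (simp add: cycle_graph_def)
  consider u v v' where "e = {(u, v), (u, v')}" "u < 3" "{v, v'} \<in> edges (cycle_graph n)"
    | u u' v where "e = {(u, v), (u', v)}" "{u, u'} \<in> edges (cycle_graph 3)" "v < n"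
    using assms unfolding cartesian_product_def by (simp add: verts) blast
  then show thesis
  proof cases
    case 1
    obtain i where i: "i < n" "{v, v'} = {i, Suc i mod n}"
      using 1(3) by (auto simp: cycle_graph_def)
    have e: "e = {(u, i), (u, Suc i mod n)}"
      using 1(1) i(2) by (auto simp: doubleton_eq_iff)
    show thesis
    proof (cases "Suc i < n")
      case True
      then show thesis using link[of i u] e 1(2) by simp
    next
      case False
      then have "i = n - 1" "Suc i = n" using i(1) by auto
      then show thesis using closing[of u] e 1(2) by (simp add: insert_commute)
    qed
  next
    case 2
    obtain i where i: "i < 3" "{u, u'} = {i, Suc i mod 3}"
      using 2(2) by (auto simp: cycle_graph_def)
    have "\<exists>a b. {i, Suc i mod 3} = {a, b} \<and> a < b \<and> b < 3"
    proof (cases "Suc i < 3")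
      case True
      then show ?thesis by (intro exI[of _ i] exI[of _ "Suc i"]) simp
    next
      case False
      then have "i = 2" using i(1) by simp
      then show ?thesis by (intro exI[of _ 0] exI[of _ 2]) (simp add: insert_commute)
    qed
    then obtain a b where "{u, u'} = {a, b}" "a < b" "b < 3"
      unfolding i(2) by (elim exE conjE)
    moreover from this(1) have "e = {(a, v), (b, v)}"
      using 2(1) by (auto simp: doubleton_eq_iff)
    ultimately show thesis using triangle[of v a b] 2(3) by blast
  qed
qed

lemma snake_chord:
  assumes "e \<in> edges (cartesian_product (cycle_graph 3) (cycle_graph n))"
  shows "\<exists>u v. e = {u, v} \<and>
    (snake u, snake v) \<in> (\<Union>i<n. triangle i) \<union>
      (\<Union>i<n - 1. link i) \<union> (\<lambda>a. (a, snake (a, n - 1))) ` {..<3}"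
  using assms
proof (cases rule: cartesian_product_cycle_cases)
  case (triangle i a b)
  then have ab: "(a = 0 \<and> b = 1) \<or> (a = 1 \<and> b = 2) \<or> (a = 0 \<and> b = 2)" by auto
  show ?thesis
  proof (cases "even i")
    case True
    then have "(snake (a, i), snake (b, i)) \<in> triangle i"
      using ab by (auto simp: snake_def triangle_def)
    then show ?thesis using triangle(1,2) by blast
  next
    case False
    then have "(snake (b, i), snake (a, i)) \<in> triangle i"
      using ab by (auto simp: snake_def triangle_def)
    moreover have "e = {(b, i), (a, i)}" using triangle(2) by blast
    ultimately show ?thesis using triangle(1) by blast
  qed
next
  case (link i a)
  then have "a = 0 \<or> a = 1 \<or> a = 2" by auto
  then have "(snake (a, i), snake (a, Suc i)) \<in> link i"
    by (auto simp: snake_def link_def)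
  moreover have "i < n - 1" using link by simp
  ultimately show ?thesis
    using link(3) by blast
next
  case (closing a)
  then have "(snake (a, 0), snake (a, n - 1)) \<in> (\<lambda>a. (a, snake (a, n - 1))) ` {..<3}"
    by (intro image_eqI[of _ _ a]) (simp_all add: snake_def)
  then show ?thesis
    using closing(2) by blast
qed

lemma even_pages_cover:
  assumes "h \<ge> 1"
  shows "(\<Union>i<2 * h. triangle i) \<union> (\<Union>i<2 * h - 1. link i) \<union> (\<lambda>a. (a, snake (a, 2 * h - 1))) ` {..<3}
    \<subseteq> \<Union>(set (even_pages h))"
proof -
  have "triangle i \<subseteq> \<Union>(set (even_pages h))" if i: "i < 2 * h" for i
  proof -
    have "(3 * i, 3 * i + 1) \<in> (\<Union>i<2 * h. {(3 * i, 3 * i + 1)})"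
      "(3 * i + 1, 3 * i + 2) \<in> (\<Union>i<2 * h. {(3 * i + 1, 3 * i + 2)})"
      "(3 * i, 3 * i + 2) \<in> (\<Union>i<2 * h. {(3 * i, 3 * i + 2)})"
      by (rule UN_I[of i]; simp add: i)+
    then show ?thesis
      unfolding even_pages_def triangle_def list.set insert_subset Union_insert Un_iff by blast
  qed
  moreover have "link i \<subseteq> \<Union>(set (even_pages h))" if "i < 2 * h - 1" for i
  proof -
    have "link i \<subseteq> (\<Union>j<h. link (2 * j)) \<union> (\<Union>j<h - 1. link (2 * j + 1))"
    proof (cases "even i")
      case True
      then obtain j where "i = 2 * j" by blast
      then show ?thesis using that by auto
    next
      case False
      then obtain j where "i = 2 * j + 1" by (rule oddE)
      then have "j < h - 1 \<and> i = 2 * j + 1" using that by auto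
      then show ?thesis by blast
    qed
    also have "\<dots> \<subseteq> \<Union>(set (even_pages h))"
      unfolding even_pages_def list.set Union_insert by blast
    finally show ?thesis .
  qed
  moreover have "(a, snake (a, 2 * h - 1)) \<in> \<Union>(set (even_pages h))" if "a < 3" for a
  proof -
    have "a = 0 \<or> a = 1 \<or> a = 2" using that by auto
    then have "(a, snake (a, 2 * h - 1)) \<in> {(0, 6 * h - 1), (1, 6 * h - 2), (2, 6 * h - 3)}"
      using assms by (auto simp: snake_def)
    then show ?thesis unfolding even_pages_def list.set Union_insert Un_iff by blast
  qed
  ultimately show ?thesis by blast
qed

lemma odd_pages_cover:
  assumes "h \<ge> 1"
  shows "(\<Union>i<2 * h + 1. triangle i) \<union> (\<Union>i<2 * h. link i) \<union> (\<lambda>a. (a, snake (a, 2 * h))) ` {..<3}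
    \<subseteq> \<Union>(set (odd_pages h))"
proof -
  have "triangle i \<subseteq> \<Union>(set (odd_pages h))" if i: "i < 2 * h + 1" for i
  proof -
    have "(3 * i, 3 * i + 2) \<in> (\<Union>i<2 * h - 1. {(3 * i, 3 * i + 2)})
        \<union> {(6 * h - 3, 6 * h - 1)} \<union> {(6 * h, 6 * h + 2)}"
    proof (cases "i < 2 * h - 1")
      case True
      then show ?thesis by (intro UnI1 UN_I[of i]) simp_all
    next
      case False
      then have "3 * i = 6 * h - 3 \<and> 3 * i + 2 = 6 * h - 1 \<or> 3 * i = 6 * h"
        using assms i by arith
      then have "(3 * i, 3 * i + 2) \<in> {(6 * h - 3, 6 * h - 1)} \<union> {(6 * h, 6 * h + 2)}"
        by auto
      then show ?thesis by (simp only: Un_iff) blast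
    qed
    moreover have "(3 * i, 3 * i + 1) \<in> (\<Union>i<2 * h + 1. {(3 * i, 3 * i + 1)})"
      "(3 * i + 1, 3 * i + 2) \<in> (\<Union>i<2 * h + 1. {(3 * i + 1, 3 * i + 2)})"
      by (rule UN_I[of i]; use i in simp)+
    ultimately show ?thesis
      unfolding odd_pages_def triangle_def list.set insert_subset Union_insert Un_iff by blast
  qed
  moreover have "link i \<subseteq> \<Union>(set (odd_pages h))" if "i < 2 * h" for i
  proof -
    have "link i \<subseteq> (\<Union>j<h. link (2 * j)) \<union> link (2 * h - 1) \<union> (\<Union>j<h - 1. link (2 * j + 1))"
    proof (cases "even i")
      case True
      then obtain j where "i = 2 * j" by blast
      then show ?thesis using that by auto
    next
      case False
      then obtain j where "i = 2 * j + 1" by (rule oddE)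
      then have "i = 2 * h - 1 \<or> j < h - 1 \<and> i = 2 * j + 1" using that by auto
      then show ?thesis by blast
    qed
    also have "\<dots> \<subseteq> \<Union>(set (odd_pages h))"
      unfolding odd_pages_def list.set Union_insert by blast
    finally show ?thesis .
  qed
  moreover have "(a, snake (a, 2 * h)) \<in> \<Union>(set (odd_pages h))" if "a < 3" for a
  proof -
    have "a = 0 \<or> a = 1 \<or> a = 2" using that by auto
    then have "(a, snake (a, 2 * h)) \<in> {(0, 6 * h), (1, 6 * h + 1), (2, 6 * h + 2)}"
      by (auto simp: snake_def)
    then show ?thesis unfolding odd_pages_def list.set Union_insert Un_iff by blast
  qed
  ultimately show ?thesis by blast
qed

lemma inj_on_snake: "inj_on snake (verts (cartesian_product (cycle_graph 3) (cycle_graph n)))"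
proof -
  \<comment> \<open>The position determines the block, and the vertex within its block.\<close>
  have block: "snake (a, i) div 3 = i" if "a < 3" for a i
    using that by (auto simp: snake_def)
  have "p = q" if pq: "p \<in> {0..<3} \<times> {0..<n}" "q \<in> {0..<3} \<times> {0..<n}" "snake p = snake q" for p q
  proof -
    obtain a i b j where ab: "p = (a, i)" "q = (b, j)" "a < 3" "b < 3"
      using pq(1,2) by auto
    then have "i = j" using pq(3) block by metis
    then show ?thesis using ab pq(3) by (auto simp: snake_def split: if_splits)
  qed
  then have "inj_on snake ({0..<3} \<times> {0..<n})"
    by (rule inj_onI)
  then show ?thesis
    by (simp add: cartesian_product_def cycle_graph_def)
qed

lemma mbt_cartesian_product_cycle_le:
  assumes n: "n \<ge> 3"
  shows "mbt (cartesian_product (cycle_graph 3) (cycle_graph n)) \<le> 5"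
proof -
  let ?G = "cartesian_product (cycle_graph 3) (cycle_graph n)"
  let ?chords = "(\<Union>i<n. triangle i) \<union> (\<Union>i<n - 1. link i) \<union> (\<lambda>a. (a, snake (a, n - 1))) ` {..<3}"
  have "\<exists>pages. length pages = 5 \<and> (\<forall>P \<in> set pages. noncrossing_matching P) \<and> ?chords \<subseteq> \<Union>(set pages)"
  proof (cases "even n")
    case True
    then obtain h where h: "n = 2 * h" by blast
    have "h \<ge> 1" using n h by simp
    then show ?thesis
      using even_pages_noncrossing[of h] even_pages_cover[of h]
      by (intro exI[of _ "even_pages h"]) (simp add: h length_even_pages)
  next
    case False
    then obtain h where h: "n = 2 * h + 1" by (rule oddE)
    have "h \<ge> 1" using n h by simp
    then show ?thesis
      using odd_pages_noncrossing[of h] odd_pages_cover[of h]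
      by (intro exI[of _ "odd_pages h"]) (simp add: h length_odd_pages)
  qed
  then obtain pages where *:
    "length pages = 5 \<and> (\<forall>P \<in> set pages. noncrossing_matching P) \<and> ?chords \<subseteq> \<Union>(set pages)"
    by (rule exE)
  note pages = *[THEN conjunct1] *[THEN conjunct2, THEN conjunct1] *[THEN conjunct2, THEN conjunct2]
  have "mbt ?G \<le> length pages"
  proof (rule mbt_le_length_pages)
    show "simple_graph ?G"
      using n by (intro simple_graph_cartesian_product simple_graph_cycle) auto
    show "\<exists>P \<in> set pages. \<exists>u v. e = {u, v} \<and> (snake u, snake v) \<in> P" if e: "e \<in> edges ?G" for e
    proof -
      obtain u v where "e = {u, v}" "(snake u, snake v) \<in> ?chords"
        using snake_chord[OF e] by (elim exE conjE)
      moreover from this(2) have "(snake u, snake v) \<in> \<Union>(set pages)"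
        using pages(3) by (rule subsetD[rotated])
      ultimately show ?thesis by blast
    qed
  qed (use pages(2) in \<open>simp_all add: inj_on_snake\<close>)
  then show ?thesis using pages(1) by simp
qed

theorem corollary3p2:
  fixes n :: nat
  assumes "n \<ge> 3"
  shows "nearly_dispersable (cartesian_product (cycle_graph 3) (cycle_graph n))"
proof -
  let ?G = "cartesian_product (cycle_graph 3) (cycle_graph n)"
  have simple: "simple_graph (cycle_graph 3)" "simple_graph (cycle_graph n)"
    by (simp_all add: simple_graph_cycle assms)
  have verts: "verts ?G = {0..<3} \<times> {0..<n}"
    by (simp add: cartesian_product_def verts_cycle_graph)
  have degree: "degree ?G v = 4" if "v \<in> verts ?G" for v
  proof -
    obtain a i where "v = (a, i)" "a < 3" "i < n" using \<open>v \<in> verts ?G\<close> verts by auto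
    then show ?thesis
      using degree_cartesian_product[OF simple, of a i] assms
      by (simp add: degree_cycle_graph verts_cycle_graph)
  qed
  have "verts ?G \<noteq> {}" using assms by (auto simp: verts)
  then have "degree ?G ` verts ?G = {4}" using degree by auto
  then have max_degree: "max_degree ?G = 4" by (simp add: max_degree_def)
  have "{i, Suc i mod 3} \<in> edges (cycle_graph 3)" if "i < 3" for i
    using that by (auto simp: cycle_graph_def)
  from this[of 0] this[of 1] this[of 2]
  have "{0, 1} \<in> edges (cycle_graph 3)" "{1, 2} \<in> edges (cycle_graph 3)" "{0, 2} \<in> edges (cycle_graph 3)"
    by (simp_all add: insert_commute numeral_2_eq_2)
  moreover have edge: "{(a, 0), (b, 0)} \<in> edges ?G" if "{a, b} \<in> edges (cycle_graph 3)" for a b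
  proof -
    have "0 \<in> verts (cycle_graph n)" using assms by (simp add: verts_cycle_graph)
    then show ?thesis using that unfolding cartesian_product_def graph.simps by blast
  qed
  ultimately have triangle: "{(0, 0), (1, 0)} \<in> edges ?G" "{(1, 0), (2, 0)} \<in> edges ?G" "{(0, 0), (2, 0)} \<in> edges ?G"
    by (simp_all only: edge)
  have "4 < mbt ?G"
    by (rule regular_triangle_degree_less_mbt[OF simple_graph_cartesian_product[OF simple] _ triangle]) (rule degree)
  with mbt_cartesian_product_cycle_le[OF assms] max_degree show ?thesis
    by (simp add: nearly_dispersable_def)
qed

end
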